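(* Let $V_n(x_1,\dots,x_n)$ denote the volume polynomial. Then: (i) for all $n\ge 1$ and $a,b\ge 0$, $$n!\,V_n(a,b,\dots,b)=a(a+nb)^{n-1};$$ (ii) for all $n\ge 3$ and $a,b,c\ge 0$, $$n!\,V_n(a,\underbrace{b,\dots,b}_{n-2\text{ places}},c)=a(a+nb)^{n-1}+na(c-b)(a+(n-1)b)^{n-2};$$ (iii) for all $n\ge 3$, $1\le m\le n-2$ and $a,b,c\ge 0$, $$n!\,V_n(a,\underbrace{b,\dots,b}_{n-m-1\text{ places}},c,\underbrace{0,\dots,0}_{m-1\text{ places}})=a\sum_{j=0}^m\binom{n}{j}\big(c-(m+1-j)b\big)^j\big(a+(n-j)b\big)^{n-j-1}.$$
   Context: For $x\in\mathbb{R}^n$ with all $x_i>0$, $V_n(x)$ is the $n$-dimensional volume of $\Pi_n(x)=\{y\in\mathbb{R}^n: y_i\ge 0 \text{ and } y_1+\cdots+y_i\le x_1+\cdots+x_i \text{ for all } 1\le i\le n\}$. It is given by a homogeneous polynomial of degree $n$ in $x_1,\dots,x_n$, called the volume polynomial, and $V_n$ is evaluated as this polynomial at arbitrary arguments (for nonnegative arguments it still equals the volume of $\Pi_n(x)$). Convention: $0^0=1$. *)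

theory Defs
  imports "HOL-Analysis.Analysis"
begin

(* A point of R^n is a function on the indices 1, ..., n that is undefined elsewhere, so that
   volume is the product measure of n copies of one-dimensional Lebesgue measure.
   Parameter vectors x are plain functions, of which only x 1, ..., x n matter. *)

definition Pi_polytope :: "nat \<Rightarrow> (nat \<Rightarrow> real) \<Rightarrow> (nat \<Rightarrow> real) set" where
  "Pi_polytope n x =
     {y \<in> extensional {1..n}. \<forall>i\<in>{1..n}. 0 \<le> y i \<and> (\<Sum>j=1..i. y j) \<le> (\<Sum>j=1..i. x j)}"

definition polytope_volume :: "nat \<Rightarrow> (nat \<Rightarrow> real) \<Rightarrow> real" where
  "polytope_volume n x = measure (Pi\<^sub>M {1..n} (\<lambda>_. lborel)) (Pi_polytope n x)"

definition exponents :: "nat \<Rightarrow> nat \<Rightarrow> (nat \<Rightarrow> nat) set" where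
  "exponents n d = {k \<in> {1..n} \<rightarrow>\<^sub>E {0..d}. (\<Sum>i=1..n. k i) = d}"

definition homogeneous_polynomial_function ::
    "nat \<Rightarrow> nat \<Rightarrow> ((nat \<Rightarrow> real) \<Rightarrow> real) \<Rightarrow> bool" where
  "homogeneous_polynomial_function n d f \<longleftrightarrow>
     (\<exists>coef :: (nat \<Rightarrow> nat) \<Rightarrow> real. \<forall>x.
        f x = (\<Sum>k\<in>exponents n d. coef k * (\<Prod>i=1..n. x i ^ k i)))"

(* The description is unique: a polynomial is determined by its values on the open positive
   orthant. The agreement with the volume is imposed only there; elsewhere V n x is the value
   of the polynomial. *)

definition V :: "nat \<Rightarrow> (nat \<Rightarrow> real) \<Rightarrow> real" where
  "V n = (THE f. homogeneous_polynomial_function n n f \<and>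
                 (\<forall>x. (\<forall>i\<in>{1..n}. 0 < x i) \<longrightarrow> f x = polytope_volume n x))"

end

(* Slicing the polytope at y_1 = x_1 - t leaves the polytope of (x_2 + t, x_3, ..., x_n), so
   V_n(x) is the integral of V_{n-1}(x_2 + t, x_3, ..., x_n) over t in [0, x_1].  This recursion
   preserves polynomials, which shows that the volume is polynomial on nonnegative arguments, and
   it turns each formula into a statement about derivatives in the first argument.  The Abel
   polynomials A_k(t) = t (t + k b)^{k-1} satisfy A_k'(t) = k A_{k-1}(t + b), exactly the
   recursion with constant increments b, and both right-hand sides are combinations of them.
   For (iii) the induction starts from (a, c, 0, ..., 0), where the formula is Abel's binomial
   identity. *)

theory Submission
  imports Defs
begin

section \<open>Slicing off the first coordinate: an integral recursion for the volume\<close>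

text \<open>The coordinates that remain after slicing keep their indices \<open>p..n\<close>, so that no
  reindexing of product measures is needed.\<close>

definition tail_polytope :: "nat \<Rightarrow> nat \<Rightarrow> (nat \<Rightarrow> real) \<Rightarrow> (nat \<Rightarrow> real) set" where
  "tail_polytope p n x =
     {y \<in> extensional {p..n}. \<forall>i\<in>{p..n}. 0 \<le> y i \<and> (\<Sum>j=p..i. y j) \<le> (\<Sum>j=p..i. x j)}"

abbreviation cube_lborel :: "nat \<Rightarrow> nat \<Rightarrow> (nat \<Rightarrow> real) measure" where
  "cube_lborel p n \<equiv> Pi\<^sub>M {p..n} (\<lambda>_. lborel)"

definition tail_volume :: "nat \<Rightarrow> nat \<Rightarrow> (nat \<Rightarrow> real) \<Rightarrow> real" where
  "tail_volume p n x = measure (cube_lborel p n) (tail_polytope p n x)"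

lemma polytope_volume_eq_tail_volume: "polytope_volume n x = tail_volume 1 n x"
  by (simp add: polytope_volume_def tail_volume_def Pi_polytope_def tail_polytope_def)

lemma tail_polytope_sets [measurable]: "tail_polytope p n x \<in> sets (cube_lborel p n)"
proof -
  have "tail_polytope p n x = {y \<in> space (cube_lborel p n).
          \<forall>i\<in>{p..n}. 0 \<le> y i \<and> (\<Sum>j=p..i. y j) \<le> (\<Sum>j=p..i. x j)}"
    by (auto simp: tail_polytope_def space_PiM PiE_def)
  moreover have "(\<lambda>y. y j) \<in> borel_measurable (cube_lborel p n)" if "j \<in> {p..n}" for j
    using measurable_component_singleton[OF that, of "\<lambda>_. lborel :: real measure"] by simp
  then have "(\<lambda>y. \<Sum>j=p..i. y j) \<in> borel_measurable (cube_lborel p n)"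
      and "(\<lambda>y. y i) \<in> borel_measurable (cube_lborel p n)" if "i \<in> {p..n}" for i
    using that by (auto intro!: borel_measurable_sum)
  then have "{y \<in> space (cube_lborel p n).
          \<forall>i\<in>{p..n}. 0 \<le> y i \<and> (\<Sum>j=p..i. y j) \<le> (\<Sum>j=p..i. x j)} \<in> sets (cube_lborel p n)"
    by (intro sets.sets_Collect_finite_All sets.sets_Collect_conj borel_measurable_le) auto
  ultimately show ?thesis by simp
qed

lemma mem_tail_polytope_insert:
  assumes "p \<le> n" "y \<in> extensional {Suc p..n}"
  shows "y(p := s) \<in> tail_polytope p n x \<longleftrightarrow>
    s \<in> {0..x p} \<and> y \<in> tail_polytope (Suc p) n (x(Suc p := x (Suc p) + (x p - s)))"
proof -
  have ext: "y(p := s) \<in> extensional {p..n}"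
    using assms by (auto simp: extensional_def)
  have ycut: "(\<Sum>j=p..i. (y(p := s)) j) = s + (\<Sum>j=Suc p..i. y j)" if "p \<le> i" for i
    by (simp add: sum.atLeast_Suc_atMost[OF that])
  have xcut: "(\<Sum>j=Suc p..i. (x(Suc p := x (Suc p) + (x p - s))) j) = (\<Sum>j=p..i. x j) - s"
    if "Suc p \<le> i" for i
    using that by (simp add: sum.atLeast_Suc_atMost)
  have split: "{p..n} = insert p {Suc p..n}" using assms by auto
  show ?thesis
    unfolding tail_polytope_def mem_Collect_eq
    using ext assms(2)
    by (auto simp: split ycut xcut simp del: fun_upd_apply) auto
qed

lemma emeasure_tail_polytope_rec:
  assumes "p \<le> n"
  shows "emeasure (cube_lborel p n) (tail_polytope p n x) =
    (\<integral>\<^sup>+s. emeasure (cube_lborel (Suc p) n)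
        (tail_polytope (Suc p) n (x(Suc p := x (Suc p) + (x p - s)))) * indicator {0..x p} s \<partial>lborel)"
proof -
  interpret product_sigma_finite "\<lambda>_::nat. lborel :: real measure" by standard
  have split: "{p..n} = insert p {Suc p..n}" using assms by auto
  have meas: "tail_polytope p n x \<in> sets (Pi\<^sub>M (insert p {Suc p..n}) (\<lambda>_. lborel))"
    using tail_polytope_sets[of p n x] by (simp only: split)
  have "emeasure (cube_lborel p n) (tail_polytope p n x) =
      (\<integral>\<^sup>+y. indicator (tail_polytope p n x) y \<partial>cube_lborel p n)"
    by simp
  also have "\<dots> = (\<integral>\<^sup>+s. (\<integral>\<^sup>+y. indicator (tail_polytope p n x) (y(p := s))
      \<partial>cube_lborel (Suc p) n) \<partial>lborel)"
    unfolding split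
    by (rule product_nn_integral_insert_rev) (use meas in auto)
  also have "\<dots> = (\<integral>\<^sup>+s. emeasure (cube_lborel (Suc p) n)
        (tail_polytope (Suc p) n (x(Suc p := x (Suc p) + (x p - s)))) * indicator {0..x p} s \<partial>lborel)"
  proof (intro nn_integral_cong)
    fix s
    have "(\<integral>\<^sup>+y. indicator (tail_polytope p n x) (y(p := s)) \<partial>cube_lborel (Suc p) n) =
      (\<integral>\<^sup>+y. indicator {0..x p} s * indicator (tail_polytope (Suc p) n
            (x(Suc p := x (Suc p) + (x p - s)))) y \<partial>cube_lborel (Suc p) n)"
      by (intro nn_integral_cong)
        (auto simp: space_PiM PiE_def mem_tail_polytope_insert[OF assms] simp del: fun_upd_apply
          split: split_indicator)
    also have "\<dots> = emeasure (cube_lborel (Suc p) n)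
        (tail_polytope (Suc p) n (x(Suc p := x (Suc p) + (x p - s)))) * indicator {0..x p} s"
      by (simp add: nn_integral_cmult mult.commute)
    finally show "(\<integral>\<^sup>+y. indicator (tail_polytope p n x) (y(p := s)) \<partial>cube_lborel (Suc p) n) =
      emeasure (cube_lborel (Suc p) n)
        (tail_polytope (Suc p) n (x(Suc p := x (Suc p) + (x p - s)))) * indicator {0..x p} s" .
  qed
  finally show ?thesis .
qed

text \<open>In the variable t = x p - s the slice volumes become \<open>g t\<close>, and any
  antiderivative integrates them. The inequality \<open>F 0 \<le> F (x p)\<close> lets later proofs
  strip \<open>ennreal\<close>, which sends negative numbers to 0.\<close>

lemma emeasure_tail_polytope_antiderivative:
  fixes F g :: "real \<Rightarrow> real"
  assumes "p \<le> n" "0 \<le> x p" "continuous_on UNIV g"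
    and deriv: "\<And>t. (F has_real_derivative g t) (at t)"
    and "\<And>t. 0 \<le> t \<Longrightarrow> t \<le> x p \<Longrightarrow> 0 \<le> g t"
    and slice: "\<And>t. 0 \<le> t \<Longrightarrow> t \<le> x p \<Longrightarrow>
      emeasure (cube_lborel (Suc p) n) (tail_polytope (Suc p) n (x(Suc p := x (Suc p) + t))) =
      ennreal (g t)"
  shows "emeasure (cube_lborel p n) (tail_polytope p n x) = ennreal (F (x p) - F 0)"
    and "F 0 \<le> F (x p)"
proof -
  show "F 0 \<le> F (x p)"
    by (rule DERIV_nonneg_imp_nondecreasing[OF assms(2)]) (use deriv assms(5) in blast)
  have "emeasure (cube_lborel p n) (tail_polytope p n x) =
      (\<integral>\<^sup>+s. ennreal (g (x p - s)) * indicator {0..x p} s \<partial>lborel)"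
    unfolding emeasure_tail_polytope_rec[OF \<open>p \<le> n\<close>]
    by (intro nn_integral_cong) (auto simp: slice split: split_indicator simp del: fun_upd_apply)
  \<comment> \<open>The substitution t = x p - s is absorbed into the antiderivative
    \<open>- F (x p - s)\<close>.\<close>
  also have "\<dots> = ennreal (- F (x p - x p) - (- F (x p - 0)))"
  proof (rule nn_integral_FTC_Icc)
    show "(\<lambda>s. g (x p - s)) \<in> borel_measurable borel"
      by (intro borel_measurable_continuous_onI continuous_on_compose2[OF assms(3)] continuous_intros) auto
    show "((\<lambda>s. - F (x p - s)) has_real_derivative g (x p - s)) (at s)" for s
      by (auto intro!: derivative_eq_intros DERIV_chain2[OF deriv])
  qed (use assms(2,5) in auto)
  finally show "emeasure (cube_lborel p n) (tail_polytope p n x) = ennreal (F (x p) - F 0)" by simp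
qed

lemma emeasure_tail_polytope_empty:
  "emeasure (Pi\<^sub>M {} (\<lambda>_. lborel)) (tail_polytope (Suc n) n x) = 1"
  by (simp add: tail_polytope_def PiM_empty emeasure_count_space)

lemma emeasure_tail_polytope_last:
  assumes "0 \<le> x n"
  shows "emeasure (cube_lborel n n) (tail_polytope n n x) = ennreal (x n)"
  using emeasure_tail_polytope_antiderivative(1)[of n n x "\<lambda>_. 1" "\<lambda>t. t", OF _ assms]
  by (simp add: emeasure_tail_polytope_empty)

section \<open>Homogeneous polynomial functions: closure, integration, uniqueness\<close>

abbreviation hpf :: "nat \<Rightarrow> nat \<Rightarrow> ((nat \<Rightarrow> real) \<Rightarrow> real) \<Rightarrow> bool" where
  "hpf \<equiv> homogeneous_polynomial_function"

lemma finite_exponents: "finite (exponents n d)"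
  unfolding exponents_def by (rule finite_subset[OF _ finite_PiE[of "{1..n}" "\<lambda>_. {0..d}"]]) auto

lemma hpf_monomial:
  assumes "(\<Sum>i=1..n. k i) = d"
  shows "hpf n d (\<lambda>x. \<Prod>i=1..n. x i ^ k i)"
proof -
  \<comment> \<open>Members of \<open>exponents n d\<close> are extensional, so \<open>k\<close> is
    cut down to \<open>{1..n}\<close> before it can serve as an index.\<close>
  define r where "r = restrict k {1..n}"
  have "k i \<le> d" if "i \<in> {1..n}" for i
    using member_le_sum[of i "{1..n}" k] that assms by auto
  then have r: "r \<in> exponents n d"
    using assms by (auto simp: exponents_def r_def)
  have "(\<Prod>i=1..n. x i ^ k i) =
      (\<Sum>l\<in>exponents n d. of_bool (l = r) * (\<Prod>i=1..n. x i ^ l i))" for x :: "nat \<Rightarrow> real"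
  proof -
    have "(\<Sum>l\<in>exponents n d. of_bool (l = r) * (\<Prod>i=1..n. x i ^ l i)) =
        (\<Sum>l\<in>exponents n d. if l = r then (\<Prod>i=1..n. x i ^ l i) else 0)"
      by (intro sum.cong) auto
    also have "\<dots> = (\<Prod>i=1..n. x i ^ r i)"
      using r by (simp add: finite_exponents)
    also have "\<dots> = (\<Prod>i=1..n. x i ^ k i)"
      by (intro prod.cong) (auto simp: r_def)
    finally show ?thesis by simp
  qed
  then show ?thesis
    unfolding homogeneous_polynomial_function_def by (intro exI[of _ "\<lambda>l. of_bool (l = r)"]) blast
qed

lemma hpf_scale: "hpf n d f \<Longrightarrow> hpf n d (\<lambda>x. c * f x)"
proof -
  assume "hpf n d f"
  then obtain a where "\<And>x. f x = (\<Sum>k\<in>exponents n d. a k * (\<Prod>i=1..n. x i ^ k i))"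
    unfolding homogeneous_polynomial_function_def by blast
  then have "c * f x = (\<Sum>k\<in>exponents n d. (c * a k) * (\<Prod>i=1..n. x i ^ k i))" for x
    by (simp add: sum_distrib_left mult.assoc)
  then show ?thesis
    unfolding homogeneous_polynomial_function_def by (intro exI[of _ "\<lambda>k. c * a k"]) blast
qed

lemma hpf_add:
  assumes "hpf n d f" "hpf n d g"
  shows "hpf n d (\<lambda>x. f x + g x)"
proof -
  from assms obtain a b where "\<And>x. f x = (\<Sum>k\<in>exponents n d. a k * (\<Prod>i=1..n. x i ^ k i))"
    "\<And>x. g x = (\<Sum>k\<in>exponents n d. b k * (\<Prod>i=1..n. x i ^ k i))"
    unfolding homogeneous_polynomial_function_def by blast
  then have "f x + g x = (\<Sum>k\<in>exponents n d. (a k + b k) * (\<Prod>i=1..n. x i ^ k i))" for x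
    by (simp add: sum.distrib distrib_right)
  then show ?thesis
    unfolding homogeneous_polynomial_function_def by (intro exI[of _ "\<lambda>k. a k + b k"]) blast
qed

lemma hpf_diff: "hpf n d f \<Longrightarrow> hpf n d g \<Longrightarrow> hpf n d (\<lambda>x. f x - g x)"
  using hpf_add[OF _ hpf_scale[of n d g "-1"]] by simp

lemma hpf_zero: "hpf n d (\<lambda>_. 0)"
  unfolding homogeneous_polynomial_function_def by (intro exI[of _ "\<lambda>_. 0"]) simp

lemma hpf_sum: "(\<And>s. s \<in> S \<Longrightarrow> hpf n d (f s)) \<Longrightarrow> hpf n d (\<lambda>x. \<Sum>s\<in>S. f s x)"
  by (induction S rule: infinite_finite_induct) (auto intro: hpf_add hpf_zero)

lemma prod_power_split_variable:
  fixes x :: "nat \<Rightarrow> real"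
  assumes "i \<in> {1..n}"
  shows "(\<Prod>j=1..n. x j ^ k j) = x i ^ k i * (\<Prod>j\<in>{1..n}-{i}. x j ^ k j)"
  using assms by (simp add: prod.remove)

text \<open>Multiplication by one variable just raises an exponent. Iterating it gives the factors
  x_i ^ e and (x_i + x_j) ^ e that appear when monomials are integrated.\<close>

lemma hpf_mult_variable:
  assumes "hpf n d f" "i \<in> {1..n}"
  shows "hpf n (Suc d) (\<lambda>x. x i * f x)"
proof -
  from assms obtain a where a: "\<And>x. f x = (\<Sum>k\<in>exponents n d. a k * (\<Prod>j=1..n. x j ^ k j))"
    unfolding homogeneous_polynomial_function_def by blast
  have "x i * f x = (\<Sum>k\<in>exponents n d. a k * (\<Prod>j=1..n. x j ^ (k(i := Suc (k i))) j))" for x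
    unfolding a prod_power_split_variable[OF assms(2)] sum_distrib_left
    by (intro sum.cong) simp_all
  moreover have "hpf n (Suc d) (\<lambda>x. \<Sum>k\<in>exponents n d. a k * (\<Prod>j=1..n. x j ^ (k(i := Suc (k i))) j))"
  proof (intro hpf_sum hpf_scale hpf_monomial)
    fix k assume "k \<in> exponents n d"
    then have "(\<Sum>j=1..n. k j) = d" by (simp add: exponents_def)
    then show "(\<Sum>j=1..n. (k(i := Suc (k i))) j) = Suc d"
      using assms(2) sum.remove[of "{1..n}" i k] by (simp add: sum.remove[of _ i])
  qed
  ultimately show ?thesis by simp
qed

lemma hpf_mult_power:
  "hpf n d f \<Longrightarrow> i \<in> {1..n} \<Longrightarrow> hpf n (e + d) (\<lambda>x. x i ^ e * f x)"
  by (induction e) (auto dest: hpf_mult_variable simp: mult.assoc)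

lemma hpf_mult_sum_power:
  assumes "hpf n d f" "i \<in> {1..n}" "j \<in> {1..n}"
  shows "hpf n (e + d) (\<lambda>x. (x i + x j) ^ e * f x)"
proof (induction e)
  case (Suc e)
  then have "hpf n (Suc (e + d)) (\<lambda>x. x i * ((x i + x j) ^ e * f x) + x j * ((x i + x j) ^ e * f x))"
    by (intro hpf_add hpf_mult_variable assms)
  then show ?case by (simp add: algebra_simps)
qed (use assms in simp)

lemma DERIV_shifted_power:
  fixes c t :: real
  shows "((\<lambda>t. (t + c) ^ Suc k) has_real_derivative real (Suc k) * (t + c) ^ k) (at t)"
  by (rule DERIV_cong[OF DERIV_power_Suc[of "\<lambda>t. t + c" 1]]) (auto intro!: derivative_eq_intros)

text \<open>One slicing step for polynomials: \<open>F x t\<close> is the integral of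
  \<open>f (x(p := x p + u))\<close> over u from 0 to t, computed monomial by monomial. Taking the
  sliced coordinate \<open>x q\<close> as upper limit gives a form of one degree more.\<close>

lemma hpf_antiderivative:
  assumes "hpf n d f" "p \<in> {1..n}" "q \<in> {1..n}"
  obtains F where "hpf n (Suc d) (\<lambda>x. F x (x q))"
    "\<And>x. F x 0 = 0"
    "\<And>x t. (F x has_real_derivative f (x(p := x p + t))) (at t)"
    "\<And>x. continuous_on UNIV (\<lambda>t. f (x(p := x p + t)))"
proof -
  from assms obtain a where a: "\<And>x. f x = (\<Sum>k\<in>exponents n d. a k * (\<Prod>j=1..n. x j ^ k j))"
    unfolding homogeneous_polynomial_function_def by blast
  define R where "R k x = (\<Prod>j\<in>{1..n}-{p}. x j ^ k j)" for k :: "nat \<Rightarrow> nat" and x :: "nat \<Rightarrow> real"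
  define F where "F x t = (\<Sum>k\<in>exponents n d. a k / real (Suc (k p)) *
    ((t + x p) ^ Suc (k p) * R k x - x p ^ Suc (k p) * R k x))" for x t
  have f: "f (x(p := x p + t)) = (\<Sum>k\<in>exponents n d. a k * ((x p + t) ^ k p * R k x))" for x t
    unfolding a prod_power_split_variable[OF assms(2)] R_def
    by (intro sum.cong) simp_all
  show thesis
  proof
    show "hpf n (Suc d) (\<lambda>x. F x (x q))" unfolding F_def
    proof (intro hpf_sum hpf_scale hpf_diff)
      fix k assume "k \<in> exponents n d"
      then have k: "(\<Sum>j=1..n. k j) = d" by (simp add: exponents_def)
      then have "hpf n (d - k p) (\<lambda>x. \<Prod>j=1..n. x j ^ (k(p := 0)) j)"
        using assms(2) sum.remove[of "{1..n}" p k] by (intro hpf_monomial) (simp add: sum.remove[of _ p])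
      moreover have "(\<Prod>j=1..n. x j ^ (k(p := 0)) j) = R k x" for x :: "nat \<Rightarrow> real"
        unfolding prod_power_split_variable[OF assms(2)] R_def by simp
      ultimately have R: "hpf n (d - k p) (R k)" by simp
      have deg: "Suc (k p) + (d - k p) = Suc d"
        using member_le_sum[of p "{1..n}" k] assms(2) k by simp
      show "hpf n (Suc d) (\<lambda>x. (x q + x p) ^ Suc (k p) * R k x)"
        using hpf_mult_sum_power[OF R assms(3,2), of "Suc (k p)"] unfolding deg .
      show "hpf n (Suc d) (\<lambda>x. x p ^ Suc (k p) * R k x)"
        using hpf_mult_power[OF R assms(2), of "Suc (k p)"] unfolding deg .
    qed
    show "F x 0 = 0" for x by (simp add: F_def)
    show "continuous_on UNIV (\<lambda>t. f (x(p := x p + t)))" for x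
      unfolding f by (intro continuous_intros)
    show "(F x has_real_derivative f (x(p := x p + t))) (at t)" for x t
      unfolding F_def f
    proof (rule DERIV_sum)
      fix k
      have "((\<lambda>t. (t + x p) ^ Suc (k p) * R k x - x p ^ Suc (k p) * R k x)
          has_real_derivative real (Suc (k p)) * (t + x p) ^ k p * R k x - 0) (at t)"
        by (intro DERIV_diff DERIV_cmult_right DERIV_shifted_power DERIV_const)
      from DERIV_cmult[OF this, of "a k / real (Suc (k p))"]
      show "((\<lambda>t. a k / real (Suc (k p)) * ((t + x p) ^ Suc (k p) * R k x - x p ^ Suc (k p) * R k x))
          has_real_derivative a k * ((x p + t) ^ k p * R k x)) (at t)"
        by (simp add: add.commute mult.assoc del: of_nat_Suc power_Suc)
    qed
  qed
qed

lemma hpf_along_diagonal: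
  assumes "hpf n d f"
  obtains P where "\<And>t. f (\<lambda>i. x i + t) = poly P t"
proof -
  from assms obtain a where a: "\<And>x. f x = (\<Sum>k\<in>exponents n d. a k * (\<Prod>j=1..n. x j ^ k j))"
    unfolding homogeneous_polynomial_function_def by blast
  have "f (\<lambda>i. x i + t) = poly (\<Sum>k\<in>exponents n d. smult (a k) (\<Prod>j=1..n. [:x j, 1:] ^ k j)) t" for t
    by (simp add: a poly_sum poly_prod)
  with that show thesis .
qed

text \<open>Every diagonal line enters the positive orthant, so the one-variable polynomial obtained by
  restricting the difference to it has infinitely many roots.\<close>

lemma hpf_eq_if_eq_on_positive_orthant:
  assumes "hpf n d f" "hpf n d g" "\<And>x. (\<forall>i\<in>{1..n}. 0 < x i) \<Longrightarrow> f x = g x"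
  shows "f = g"
proof
  fix x :: "nat \<Rightarrow> real"
  obtain P where P: "\<And>t. f (\<lambda>i. x i + t) - g (\<lambda>i. x i + t) = poly P t"
    using hpf_along_diagonal[OF hpf_diff[OF assms(1,2)], of x] by blast
  \<comment> \<open>\<open>M\<close> bounds every \<bar>x i\<bar>, so t > M moves all coordinates
    into the positive range.\<close>
  define M where "M = (\<Sum>i=1..n. \<bar>x i\<bar>)"
  have "poly P t = 0" if "M < t" for t
  proof -
    have "0 < x i + t" if "i \<in> {1..n}" for i
      using member_le_sum[of i "{1..n}" "\<lambda>i. \<bar>x i\<bar>"] that \<open>M < t\<close> unfolding M_def by fastforce
    then show ?thesis using assms(3)[of "\<lambda>i. x i + t"] P[of t] by simp
  qed
  then have "{M<..} \<subseteq> {t. poly P t = 0}" by auto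
  then have "P = 0"
    using poly_roots_finite infinite_Ioi finite_subset by metis
  then show "f x = g x" using P[of 0] by simp
qed

section \<open>Polynomiality of the volume and the meaning of \<open>V\<close>\<close>

text \<open>Downward induction on \<open>p\<close>: each slicing step integrates a polynomial and
  raises the degree by one, up to the number \<open>Suc n - p\<close> of coordinates left. The bound
  \<open>0 \<le> f x\<close> is carried along because the integration step asks for nonnegative
  slice volumes.\<close>

lemma hpf_tail_volume:
  assumes "p \<in> {1..n}"
  shows "\<exists>f. hpf n (Suc n - p) f \<and> (\<forall>x. (\<forall>i\<in>{p..n}. 0 \<le> x i) \<longrightarrow>
     0 \<le> f x \<and> emeasure (cube_lborel p n) (tail_polytope p n x) = ennreal (f x))"
  using assms
proof (induction "n - p" arbitrary: p)
  case 0
  then have [simp]: "p = n" "0 < n" by auto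
  have "hpf n 1 (\<lambda>x. x n * (\<Prod>i=1..n. x i ^ 0))"
    using hpf_mult_variable[OF hpf_monomial[of "\<lambda>_. 0" n 0], of n] by (simp add: Suc_le_eq)
  then show ?case
    by (intro exI[of _ "\<lambda>x. x n"]) (auto simp: emeasure_tail_polytope_last simp del: atLeastAtMost_singleton)
next
  case (Suc l)
  then have p: "p \<in> {1..n}" "Suc p \<in> {1..n}" "p \<le> n" by auto
  have deg: "Suc (Suc n - Suc p) = Suc n - p" using p by auto
  have "l = n - Suc p" using Suc(2) by simp
  from Suc(1)[OF this p(2)] obtain f where f: "hpf n (Suc n - Suc p) f"
    "\<And>x. \<forall>i\<in>{Suc p..n}. 0 \<le> x i \<Longrightarrow> 0 \<le> f x \<and>
      emeasure (cube_lborel (Suc p) n) (tail_polytope (Suc p) n x) = ennreal (f x)"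
    by blast
  \<comment> \<open>Coordinate \<open>Suc p\<close> receives the slack, and \<open>x p\<close> is
    the upper limit of integration.\<close>
  from hpf_antiderivative[OF f(1) p(2,1)] obtain F where
    F: "hpf n (Suc n - p) (\<lambda>x. F x (x p))" "\<And>x. F x 0 = 0"
    and F': "\<And>x t. (F x has_real_derivative f (x(Suc p := x (Suc p) + t))) (at t)"
    and cont: "\<And>x. continuous_on UNIV (\<lambda>t. f (x(Suc p := x (Suc p) + t)))"
    unfolding deg by blast
  have "0 \<le> F x (x p) \<and> emeasure (cube_lborel p n) (tail_polytope p n x) = ennreal (F x (x p))"
    if x: "\<forall>i\<in>{p..n}. 0 \<le> x i" for x
  proof -
    let ?g = "\<lambda>t. f (x(Suc p := x (Suc p) + t))"
    have g: "0 \<le> ?g t \<and> emeasure (cube_lborel (Suc p) n)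
        (tail_polytope (Suc p) n (x(Suc p := x (Suc p) + t))) = ennreal (?g t)" if "0 \<le> t" for t
      using x p that by (intro f(2)) auto
    have "emeasure (cube_lborel p n) (tail_polytope p n x) = ennreal (F x (x p) - F x 0)"
      "F x 0 \<le> F x (x p)"
      using x p g by (intro emeasure_tail_polytope_antiderivative[OF _ _ cont F']; auto)+
    then show ?thesis by (simp add: F(2))
  qed
  with F(1) show ?case by blast
qed


text \<open>The polynomial representation shows that the volume is finite, so nothing is lost by
  \<open>measure\<close>, which is 0 on sets of infinite measure.\<close>

lemma emeasure_eq_tail_volume:
  assumes "p \<in> {1..n}" "\<forall>i\<in>{p..n}. 0 \<le> x i"
  shows "emeasure (cube_lborel p n) (tail_polytope p n x) = ennreal (tail_volume p n x)"
  using hpf_tail_volume[OF assms(1)] assms(2) by (auto simp: tail_volume_def measure_def)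

lemma V_eq_tail_volume:
  assumes "1 \<le> n" "\<forall>i\<in>{1..n}. 0 \<le> x i"
  shows "V n x = tail_volume 1 n x"
proof -
  obtain f where f: "hpf n n f" and "\<And>x. \<forall>i\<in>{1..n}. 0 \<le> x i \<Longrightarrow>
     0 \<le> f x \<and> emeasure (cube_lborel 1 n) (tail_polytope 1 n x) = ennreal (f x)"
    using hpf_tail_volume[of 1 n] assms(1) by auto
  then have f_eq: "f x = tail_volume 1 n x" if "\<forall>i\<in>{1..n}. 0 \<le> x i" for x
    using that by (simp add: tail_volume_def measure_def)
  have "V n = f"
    unfolding V_def polytope_volume_eq_tail_volume
  proof (rule the_equality)
    show "hpf n n f \<and> (\<forall>x. (\<forall>i\<in>{1..n}. 0 < x i) \<longrightarrow> f x = tail_volume 1 n x)"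
      using f f_eq less_imp_le by blast
    then show "g = f" if "hpf n n g \<and> (\<forall>x. (\<forall>i\<in>{1..n}. 0 < x i) \<longrightarrow> g x = tail_volume 1 n x)" for g
      using that by (intro hpf_eq_if_eq_on_positive_orthant[of n n]) auto
  qed
  then show ?thesis using f_eq[OF assms(2)] by simp
qed

lemma tail_volume_last:
  assumes "0 \<le> x n"
  shows "tail_volume n n x = x n"
  using emeasure_tail_polytope_last[of x n] assms
  by (simp add: tail_volume_def measure_def)

text \<open>The tool for closed forms: a guess \<open>F\<close> is verified by checking that it
  vanishes at 0 and that its derivative is the slice volume.\<close>

lemma tail_volume_antiderivative:
  fixes F g :: "real \<Rightarrow> real"
  assumes "1 \<le> p" "p < n" "\<forall>i\<in>{p..n}. 0 \<le> x i" "continuous_on UNIV g"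
    and "\<And>t. (F has_real_derivative g t) (at t)" "F 0 = 0"
    and slice: "\<And>t. 0 \<le> t \<Longrightarrow> tail_volume (Suc p) n (x(Suc p := x (Suc p) + t)) = g t"
  shows "tail_volume p n x = F (x p)"
proof -
  \<comment> \<open>Nonnegativity of \<open>g t\<close> needs no look at its formula, since it is a
    measure.\<close>
  have E: "emeasure (cube_lborel (Suc p) n) (tail_polytope (Suc p) n (x(Suc p := x (Suc p) + t))) =
      ennreal (g t)" and g: "0 \<le> g t" if "0 \<le> t" for t
    using assms(2,3) that emeasure_eq_tail_volume[of "Suc p" n "x(Suc p := x (Suc p) + t)"]
    by (auto simp flip: slice[OF that] simp: tail_volume_def)
  have "emeasure (cube_lborel p n) (tail_polytope p n x) = ennreal (F (x p) - F 0)"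
      "F 0 \<le> F (x p)"
    using E g assms(2,3) by (intro emeasure_tail_polytope_antiderivative[OF _ _ assms(4,5)]; auto)+
  then show ?thesis by (simp add: assms(6) tail_volume_def measure_def)
qed

section \<open>Abel polynomials and Abel's binomial identity\<close>

text \<open>The value at \<open>k = 0\<close> is that of \<open>t (t + 0 b)\<^sup>-\<^sup>1\<close>, which truncated subtraction would not give.\<close>

fun abel_poly :: "real \<Rightarrow> nat \<Rightarrow> real \<Rightarrow> real" where
  "abel_poly b 0 t = 1"
| "abel_poly b (Suc k) t = t * (t + real (Suc k) * b) ^ k"

text \<open>Serves the case of zero increments, where the polytope is a scaled simplex.\<close>

lemma abel_poly_0_left: "abel_poly 0 k t = t ^ k"
  by (cases k) auto

lemma abel_poly_1: "abel_poly b (Suc 0) = (\<lambda>t. t)"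
  by (rule ext) simp

lemma abel_poly_at_0: "abel_poly b k 0 = of_bool (k = 0)"
  by (cases k) auto

lemma continuous_on_abel_poly [continuous_intros]:
  "continuous_on S f \<Longrightarrow> continuous_on S (\<lambda>t. abel_poly b k (f t))"
  by (cases k) (auto intro!: continuous_intros)

lemma abel_poly_derivative:
  "(abel_poly b (Suc k) has_real_derivative real (Suc k) * abel_poly b k (t + b)) (at t)"
proof (cases k)
  case (Suc l)
  have "((\<lambda>t. t * (t + real (Suc k) * b) ^ k) has_real_derivative
      1 * (t + real (Suc k) * b) ^ k + real k * (t + real (Suc k) * b) ^ l * t) (at t)"
    unfolding Suc by (rule DERIV_mult[OF DERIV_ident DERIV_shifted_power])
  \<comment> \<open>Taking out (t + (k+1) b)^l leaves t + (k+1) b + k t = (k+1)(t + b), and the base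
    agrees because (t + b) + k b = t + (k+1) b.\<close>
  also have "1 * (t + real (Suc k) * b) ^ k + real k * (t + real (Suc k) * b) ^ l * t =
      real (Suc k) * abel_poly b k (t + b)"
    by (simp add: Suc algebra_simps)
  also have "(\<lambda>t. t * (t + real (Suc k) * b) ^ k) = abel_poly b (Suc k)"
    by (rule ext) simp
  finally show ?thesis .
qed (simp add: abel_poly_1)

text \<open>The weights \<open>w\<close> are arbitrary because Abel's identity and the volume
  formula use different ones. The bound \<open>m \<le> L\<close> keeps every Abel index
  \<open>Suc L - j\<close> positive, so the derivative rule applies termwise.\<close>

lemma binomial_abel_sum_derivative:
  assumes "m \<le> L"
  shows "((\<lambda>t. \<Sum>j=0..m. real (Suc L choose j) * w j * abel_poly b (Suc L - j) t)
    has_real_derivative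
      real (Suc L) * (\<Sum>j=0..m. real (L choose j) * w j * abel_poly b (L - j) (t + b))) (at t)"
  unfolding sum_distrib_left
proof (rule DERIV_sum)
  fix j assume "j \<in> {0..m}"
  then have j: "Suc L - j = Suc (L - j)" using assms by auto
  \<comment> \<open>Absorption trades the factor produced by differentiation for
    \<open>Suc L\<close>, which is common to all summands.\<close>
  have "real (Suc L choose j) * real (Suc (L - j)) = real (Suc L) * real (L choose j)"
    using binomial_absorb_comp[of "Suc L" j] unfolding j
    by (metis diff_Suc_1 mult.commute of_nat_mult)
  moreover have "real (Suc L choose j) * w j * (real (Suc (L - j)) * abel_poly b (L - j) (t + b)) =
      (real (Suc L choose j) * real (Suc (L - j))) * (w j * abel_poly b (L - j) (t + b))"
    by (simp only: ac_simps)
  ultimately have "real (Suc L choose j) * w j * (real (Suc (L - j)) * abel_poly b (L - j) (t + b)) =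
      real (Suc L) * (real (L choose j) * w j * abel_poly b (L - j) (t + b))"
    by (simp only: mult.assoc)
  with DERIV_cmult[OF abel_poly_derivative, of "real (Suc L choose j) * w j" b "L - j" t]
  show "((\<lambda>t. real (Suc L choose j) * w j * abel_poly b (Suc L - j) t) has_real_derivative
      real (Suc L) * (real (L choose j) * w j * abel_poly b (L - j) (t + b))) (at t)"
    unfolding j by (simp del: abel_poly.simps of_nat_Suc)
qed

text \<open>Both sides have the same derivative in a, by the induction hypothesis at (a + b, c - b),
  so it remains to compare them at a = 0.\<close>

lemma abel_binomial_identity:
  "(\<Sum>j=0..L. real (L choose j) * (c - real (L - j) * b) ^ j * abel_poly b (L - j) a) = (a + c) ^ L"
proof (induction L arbitrary: a c)
  case (Suc L)
  define w where "w j = (c - real (Suc L - j) * b) ^ j" for j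
  \<comment> \<open>\<open>S\<close> leaves out the top summand j = L+1, which is
    \<open>c ^ Suc L\<close> for every t; all the others vanish at t = 0.\<close>
  define S where "S t = (\<Sum>j=0..L. real (Suc L choose j) * w j * abel_poly b (Suc L - j) t)" for t
  have "(S has_real_derivative real (Suc L) * (t + c) ^ L) (at t)" for t
  proof -
    \<comment> \<open>The weights fit the induction hypothesis since c - (L+1-j) b = (c - b) - (L-j)
      b, and the two shifts cancel in (t + b) + (c - b).\<close>
    have "(\<Sum>j=0..L. real (L choose j) * w j * abel_poly b (L - j) (t + b)) =
        (\<Sum>j=0..L. real (L choose j) * ((c - b) - real (L - j) * b) ^ j * abel_poly b (L - j) (t + b))"
      by (intro sum.cong) (auto simp: w_def Suc_diff_le algebra_simps)
    also have "\<dots> = (t + c) ^ L" unfolding Suc.IH by simp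
    finally show ?thesis
      using binomial_abel_sum_derivative[of L L w b t] unfolding S_def by simp
  qed
  from DERIV_diff[OF this DERIV_shifted_power[of c L]]
  have "((\<lambda>t. S t - (t + c) ^ Suc L) has_real_derivative 0) (at t)" for t
    by (simp del: power_Suc)
  then have "S a - (a + c) ^ Suc L = S 0 - (0 + c) ^ Suc L"
    by (intro DERIV_isconst_all) blast
  moreover have "S 0 = 0"
    unfolding S_def by (intro sum.neutral) (auto simp: abel_poly_at_0)
  ultimately have "S a + c ^ Suc L = (a + c) ^ Suc L" by simp
  then show ?case by (simp add: S_def w_def)
qed simp

section \<open>Closed forms of the volumes by downward induction\<close>

text \<open>The entry \<open>x p\<close> stays arbitrary because slicing turns the next increment b
  into b + t, exactly the shift in the derivative of the Abel polynomials; the factorial absorbs the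
  factor from differentiation.\<close>

lemma tail_volume_constant:
  assumes "p \<in> {1..n}" "0 \<le> x p" "0 \<le> b" "\<And>i. p < i \<Longrightarrow> i \<le> n \<Longrightarrow> x i = b"
  shows "fact (Suc n - p) * tail_volume p n x = abel_poly b (Suc n - p) (x p)"
  using assms
proof (induction "n - p" arbitrary: p x)
  case 0
  then have "p = n" by simp
  then show ?case using 0 by (simp add: tail_volume_last)
next
  case (Suc l)
  then have p: "1 \<le> p" "p < n" "Suc n - p = Suc (Suc l)" "Suc n - Suc p = Suc l" by auto
  have "tail_volume p n x = abel_poly b (Suc (Suc l)) (x p) / fact (Suc (Suc l))"
  proof (rule tail_volume_antiderivative[OF p(1,2), where F = "\<lambda>t. abel_poly b (Suc (Suc l)) t / fact (Suc (Suc l))"])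
    have "0 \<le> x i" if "i \<in> {p..n}" for i
      using that Suc.prems by (cases "i = p") auto
    then show "\<forall>i\<in>{p..n}. 0 \<le> x i" by blast
    show "continuous_on UNIV (\<lambda>t. abel_poly b (Suc l) (t + b) / fact (Suc l))"
      by (intro continuous_intros) auto
    show "((\<lambda>t. abel_poly b (Suc (Suc l)) t / fact (Suc (Suc l))) has_real_derivative
        abel_poly b (Suc l) (t + b) / fact (Suc l)) (at t)" for t
      using DERIV_cdivide[OF abel_poly_derivative[of b "Suc l" t], of "fact (Suc (Suc l))"]
      by (simp add: field_simps del: abel_poly.simps of_nat_Suc)
    show "tail_volume (Suc p) n (x(Suc p := x (Suc p) + t)) = abel_poly b (Suc l) (t + b) / fact (Suc l)"
      if "0 \<le> t" for t
      using Suc(1)[of "Suc p" "x(Suc p := x (Suc p) + t)"] Suc(2) Suc.prems p that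
      by (simp add: field_simps del: abel_poly.simps fact_Suc)
  qed simp
  then show ?case unfolding p by (simp del: abel_poly.simps fact_Suc)
qed

text \<open>Here \<open>q\<close> is the last index of the b-block, and the induction is on its
  length. The weights \<open>c - real (Suc m - j) * b\<close> stay fixed throughout; each step
  changes only the binomial coefficients and the Abel indices.\<close>

lemma tail_volume_constant_then_zeros:
  assumes "1 \<le> p" "p \<le> q" "n = q + m" "1 \<le> m" "0 \<le> x p" "0 \<le> b" "0 \<le> c"
    and "\<And>i. p < i \<Longrightarrow> i \<le> q \<Longrightarrow> x i = b" "x (Suc q) = c"
    and "\<And>i. Suc q < i \<Longrightarrow> i \<le> n \<Longrightarrow> x i = 0"
  shows "fact (Suc n - p) * tail_volume p n x =
    (\<Sum>j=0..m. real (Suc n - p choose j) * (c - real (Suc m - j) * b) ^ j *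
      abel_poly b (Suc n - p - j) (x p))"
  using assms
proof (induction "q - p" arbitrary: p x)
  case 0
  have q: "q = p" "p < n" "Suc n - p = Suc m"
    using 0(1) "0.prems"(1-4) by auto
  \<comment> \<open>The slice is (c + t, 0, ..., 0) in m coordinates; subtracting
    \<open>c ^ Suc m\<close> makes the antiderivative vanish at 0.\<close>
  have "tail_volume p n x = ((x p + c) ^ Suc m - c ^ Suc m) / fact (Suc m)"
  proof (rule tail_volume_antiderivative[OF 0(2) q(2), where F = "\<lambda>t. ((t + c) ^ Suc m - c ^ Suc m) / fact (Suc m)"])
    have "0 \<le> x i" if i: "i \<in> {p..n}" for i
    proof -
      consider "i = p" | "i = Suc q" | "Suc q < i" "i \<le> n"
        using i q(1) by fastforce
      then show ?thesis
        using "0.prems"(5,7,9,10) by cases auto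
    qed
    then show "\<forall>i\<in>{p..n}. 0 \<le> x i" by blast
    show "continuous_on UNIV (\<lambda>t. (t + c) ^ m / fact m)"
      by (intro continuous_intros) auto
    show "((\<lambda>t. ((t + c) ^ Suc m - c ^ Suc m) / fact (Suc m)) has_real_derivative
        (t + c) ^ m / fact m) (at t)" for t
    proof -
      have "((\<lambda>t. (t + c) ^ Suc m - c ^ Suc m) has_real_derivative real (Suc m) * (t + c) ^ m - 0) (at t)"
        by (intro DERIV_diff DERIV_shifted_power DERIV_const)
      from DERIV_cdivide[OF this, of "fact (Suc m)"] show ?thesis
        by (simp del: of_nat_Suc power_Suc)
    qed
    show "tail_volume (Suc p) n (x(Suc p := x (Suc p) + t)) = (t + c) ^ m / fact m"
      if "0 \<le> t" for t
    proof -
      have "fact (Suc n - Suc p) * tail_volume (Suc p) n (x(Suc p := x (Suc p) + t)) =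
          abel_poly 0 (Suc n - Suc p) ((x(Suc p := x (Suc p) + t)) (Suc p))"
        using "0.prems"(7,9,10) q(1,2) that by (intro tail_volume_constant) auto
      moreover have "Suc n - Suc p = m" "x (Suc p) = c"
        using "0.prems"(9) q by auto
      ultimately show ?thesis
        by (simp add: abel_poly_0_left field_simps)
    qed
  qed simp
  then show ?case
    \<comment> \<open>Abel's identity has one more summand, j = m+1, equal to the subtracted
      \<open>c ^ Suc m\<close>. It also brings in b, which this polytope does not yet
      contain.\<close>
    using abel_binomial_identity[of "Suc m" c b "x p"] unfolding q
    by (simp del: fact_Suc)
next
  case (Suc l)
  define L where "L = n - p"
  have p: "p < q" "Suc p \<le> n" "Suc n - p = Suc L" "Suc n - Suc p = L" "m \<le> L" "p < n"
    using Suc.prems(1-4) Suc(2) by (auto simp: L_def)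
  define w where "w j = (c - real (Suc m - j) * b) ^ j" for j
  define F where "F t = (\<Sum>j=0..m. real (Suc L choose j) * w j * abel_poly b (Suc L - j) t)" for t
  define g where "g t = (\<Sum>j=0..m. real (L choose j) * w j * abel_poly b (L - j) (t + b))" for t
  have "tail_volume p n x = F (x p) / fact (Suc L)"
  proof (rule tail_volume_antiderivative[OF Suc.prems(1) \<open>p < n\<close>, where F = "\<lambda>t. F t / fact (Suc L)"])
    have "0 \<le> x i" if i: "i \<in> {p..n}" for i
    proof -
      consider "i = p" | "p < i" "i \<le> q" | "i = Suc q" | "Suc q < i" "i \<le> n"
        using i by fastforce
      then show ?thesis
        using Suc.prems(5-10) by cases auto
    qed
    then show "\<forall>i\<in>{p..n}. 0 \<le> x i" by blast
    show "continuous_on UNIV (\<lambda>t. g t / fact L)"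
      unfolding g_def by (intro continuous_intros) auto
    show "((\<lambda>t. F t / fact (Suc L)) has_real_derivative g t / fact L) (at t)" for t
      using DERIV_cdivide[OF binomial_abel_sum_derivative[OF \<open>m \<le> L\<close>, of w b t], of "fact (Suc L)"]
      unfolding F_def[symmetric] g_def[symmetric]
      by (simp add: field_simps del: of_nat_Suc)
    \<comment> \<open>Since j \<le> m \<le> L, no Abel index is 0, so every summand vanishes at t =
      0.\<close>
    show "F 0 / fact (Suc L) = 0"
      unfolding F_def using p by (simp add: abel_poly_at_0)
    show "tail_volume (Suc p) n (x(Suc p := x (Suc p) + t)) = g t / fact L" if "0 \<le> t" for t
    proof -
      have x_Suc: "x (Suc p) = b" using Suc.prems(8) p(1) by simp
      have "fact (Suc n - Suc p) * tail_volume (Suc p) n (x(Suc p := x (Suc p) + t)) =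
        (\<Sum>j=0..m. real (Suc n - Suc p choose j) * (c - real (Suc m - j) * b) ^ j *
          abel_poly b (Suc n - Suc p - j) ((x(Suc p := x (Suc p) + t)) (Suc p)))"
      proof (rule Suc(1))
        show "l = q - Suc p" using Suc(2) by simp
      qed (use Suc.prems(3-10) p(1) x_Suc that in simp_all)
      also have "\<dots> = g t"
        unfolding p(4) by (simp add: g_def w_def x_Suc add.commute)
      finally have "fact (Suc n - Suc p) * tail_volume (Suc p) n (x(Suc p := x (Suc p) + t)) = g t" .
      then show ?thesis unfolding p by (simp add: field_simps)
    qed
  qed
  then show ?case unfolding p by (simp add: F_def w_def del: fact_Suc)
qed

section \<open>Specialization to the vectors in (i), (ii) and (iii)\<close>

theorem mainTheorem2:
  shows "(\<forall>(n::nat) (a::real) (b::real). n \<ge> 1 \<longrightarrow> a \<ge> 0 \<longrightarrow> b \<ge> 0 \<longrightarrow>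
            fact n * V n (\<lambda>i. if i = 1 then a else b) = a * (a + real n * b) ^ (n - 1))
       \<and> (\<forall>(n::nat) (a::real) (b::real) (c::real).
            n \<ge> 3 \<longrightarrow> a \<ge> 0 \<longrightarrow> b \<ge> 0 \<longrightarrow> c \<ge> 0 \<longrightarrow>
            fact n * V n (\<lambda>i. if i = 1 then a else if i = n then c else b) =
              a * (a + real n * b) ^ (n - 1)
              + real n * a * (c - b) * (a + (real n - 1) * b) ^ (n - 2))
       \<and> (\<forall>(n::nat) (m::nat) (a::real) (b::real) (c::real).
            n \<ge> 3 \<longrightarrow> 1 \<le> m \<longrightarrow> m \<le> n - 2 \<longrightarrow> a \<ge> 0 \<longrightarrow> b \<ge> 0 \<longrightarrow> c \<ge> 0 \<longrightarrow>
            fact n * V n (\<lambda>i. if i = 1 then a else if i \<le> n - m then b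
                              else if i = n - m + 1 then c else 0) =
              a * (\<Sum>j=0..m. real (n choose j) * (c - (real m + 1 - real j) * b) ^ j
                              * (a + (real n - real j) * b) ^ (n - j - 1)))"
proof (intro conjI allI impI)
  have abel: "abel_poly b k t = t * (t + real k * b) ^ (k - 1)" if "1 \<le> k" for b t k
    using that by (cases k) auto
  show "fact n * V n (\<lambda>i. if i = 1 then a else b) = a * (a + real n * b) ^ (n - 1)"
    if "1 \<le> n" "0 \<le> a" "0 \<le> b" for n and a b :: real
    using tail_volume_constant[of 1 n "\<lambda>i. if i = 1 then a else b" b] that
    by (simp add: V_eq_tail_volume abel)
  \<comment> \<open>The vector is given only through its entries so that (ii) is covered too: for m
    = 1 the entry c sits in the last place and no zeros follow.\<close>
  have formula: "fact n * V n x = x 1 * (\<Sum>j=0..m. real (n choose j) *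
      (c - (real m + 1 - real j) * b) ^ j * (x 1 + (real n - real j) * b) ^ (n - j - 1))"
    if "1 \<le> m" "m \<le> n - 2" "2 \<le> n" "0 \<le> x 1" "0 \<le> b" "0 \<le> c"
      and x: "\<And>i. 1 < i \<Longrightarrow> i \<le> n - m \<Longrightarrow> x i = b" "x (Suc (n - m)) = c"
        "\<And>i. Suc (n - m) < i \<Longrightarrow> i \<le> n \<Longrightarrow> x i = 0"
    for n m :: nat and b c :: real and x :: "nat \<Rightarrow> real"
  proof -
    have "0 \<le> x i" if "i \<in> {1..n}" for i
      using that x \<open>0 \<le> x 1\<close> \<open>0 \<le> b\<close> \<open>0 \<le> c\<close>
      by (cases "i = 1"; cases "i \<le> n - m"; cases "i = Suc (n - m)") auto
    then have "fact n * V n x = fact (Suc n - 1) * tail_volume 1 n x"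
      using that by (simp add: V_eq_tail_volume)
    also have "\<dots> = (\<Sum>j=0..m. real (Suc n - 1 choose j) * (c - real (Suc m - j) * b) ^ j *
        abel_poly b (Suc n - 1 - j) (x 1))"
      using that by (intro tail_volume_constant_then_zeros[of 1 "n - m"]) auto
    also have "\<dots> = x 1 * (\<Sum>j=0..m. real (n choose j) *
        (c - (real m + 1 - real j) * b) ^ j * (x 1 + (real n - real j) * b) ^ (n - j - 1))"
      unfolding sum_distrib_left
    proof (intro sum.cong)
      fix j assume "j \<in> {0..m}"
      \<comment> \<open>From j \<le> m \<le> n - 2 the truncated subtractions are exact and the Abel
        indices positive, as \<open>abel\<close> requires.\<close>
      then have "1 \<le> n - j" "real (Suc m - j) = real m + 1 - real j" "real (n - j) = real n - real j"
        using that by auto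
      then show "real (Suc n - 1 choose j) * (c - real (Suc m - j) * b) ^ j *
        abel_poly b (Suc n - 1 - j) (x 1) = x 1 * (real (n choose j) *
        (c - (real m + 1 - real j) * b) ^ j * (x 1 + (real n - real j) * b) ^ (n - j - 1))"
        by (simp add: abel)
    qed simp
    finally show ?thesis .
  qed
  show "fact n * V n (\<lambda>i. if i = 1 then a else if i = n then c else b) =
      a * (a + real n * b) ^ (n - 1) + real n * a * (c - b) * (a + (real n - 1) * b) ^ (n - 2)"
    if "3 \<le> n" "0 \<le> a" "0 \<le> b" "0 \<le> c" for n and a b c :: real
  proof -
    have "fact n * V n (\<lambda>i. if i = 1 then a else if i = n then c else b) =
      a * (\<Sum>j=0..1. real (n choose j) * (c - (real 1 + 1 - real j) * b) ^ j
              * (a + (real n - real j) * b) ^ (n - j - 1))"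
      by (subst formula[of 1 n _ b c]) (use that in auto)
    \<comment> \<open>The summand j = 0 is the first term; j = 1 has weight c - b and gives the
      second.\<close>
    also have "\<dots> = a * (a + real n * b) ^ (n - 1)
        + real n * a * (c - b) * (a + (real n - 1) * b) ^ (n - 2)"
      by (simp add: distrib_left numeral_2_eq_2)
    finally show ?thesis .
  qed
  show "fact n * V n (\<lambda>i. if i = 1 then a else if i \<le> n - m then b
          else if i = n - m + 1 then c else 0) =
        a * (\<Sum>j=0..m. real (n choose j) * (c - (real m + 1 - real j) * b) ^ j
              * (a + (real n - real j) * b) ^ (n - j - 1))"
    if "3 \<le> n" "1 \<le> m" "m \<le> n - 2" "0 \<le> a" "0 \<le> b" "0 \<le> c" for n m and a b c :: real
    by (subst formula[of m n _ b c]) (use that in auto)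
qed

end
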